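(* Let $p=0.99$, $\delta\in(0,1)$, and let $\epsilon_0,\epsilon_i\in[0,1]$. Let $T_0=\lceil 8p\log(1/\delta)\rceil$ and let $B_{0,1},\dots,B_{0,T_0}\in\mathbb{R}^{d\times k}$ be the column-orthonormal outputs of $T_0$ independent trials of a randomized procedure (the private power method), each trial being successful, i.e. satisfying $\mathrm{dist}(B_{0,c},B^* )\le\epsilon_i$, with probability at least $p$. Then with probability at least $1-\delta$ there exists $\hat c\in\{1,\dots,T_0\}$ such that for at least half of the $c\in\{1,\dots,T_0\}$, $$s_i(B_{0,c}^\top B_{0,\hat c})\ge1-2\epsilon_i^2\quad\text{for all }i\in\{1,\dots,k\}.\qquad(\ast)$$ Moreover (on the same event), if $\epsilon_i$ is sufficiently small that $$\sqrt{1-\epsilon_0^2}+1-\sqrt{1-\epsilon_i^2}+\epsilon_i<1-2\epsilon_i^2,$$ then every $\hat c$ for which $(\ast)$ holds for at least half of the $c$ satisfies $\mathrm{dist}(B_{0,\hat c},B^* )\le\epsilon_0$. One valid choice is $\epsilon_i=0.01$, $\epsilon_0=0.2$.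
   Context: $B^*\in\mathbb{R}^{d\times k}$ is a fixed matrix with orthonormal columns, $1\le k\le d$. For matrices $B,B'$ with orthonormal columns, $\mathrm{dist}(B,B')=\|(I_d-BB^\top)B'\|_2$ (spectral norm). $s_i(A)$ denotes the $i$-th largest singular value of $A$. *)

theory Defs
  imports
    "HOL-Probability.Probability"
    "HOL-Computational_Algebra.Computational_Algebra"
begin

definition orthonormal_columns :: "real^'k^'d \<Rightarrow> bool" where
  "orthonormal_columns B \<longleftrightarrow>
     (\<forall>i j. column i B \<bullet> column j B = (if i = j then 1 else 0))"

definition spectral_norm :: "real^'n^'m \<Rightarrow> real" where
  "spectral_norm A = onorm ((*v) A)"

definition subspace_dist :: "real^'k^'d \<Rightarrow> real^'k^'d \<Rightarrow> real" where
  "subspace_dist B B' = spectral_norm ((mat 1 - B ** transpose B) ** B')"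

definition charpoly :: "real^'n^'n \<Rightarrow> real poly" where
  "charpoly A = det (mat [:0, 1:] - (\<chi> i j. [:A $ i $ j:]))"

text \<open>The \<open>i\<close>-th largest singular value of \<open>A\<close>, counted from \<open>i = 1\<close>: the square root of
  the \<open>i\<close>-th largest eigenvalue of \<open>A\<^sup>T A\<close>. Eigenvalues are listed with algebraic multiplicity,
  as \<^const>\<open>proots\<close> counts roots with multiplicity. As \<open>A\<^sup>T A\<close> is symmetric, its characteristic
  polynomial splits over the reals and the list has \<open>CARD('n)\<close> entries, so the index is
  in range exactly for \<open>1 \<le> i \<le> CARD('n)\<close>.\<close>

definition singular_value :: "nat \<Rightarrow> real^'n^'m \<Rightarrow> real" where
  "singular_value i A =
     sqrt (rev (sorted_list_of_multiset (proots (charpoly (transpose A ** A)))) ! (i - 1))"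

definition close_to_half ::
    "nat \<Rightarrow> real \<Rightarrow> (nat \<Rightarrow> real^'k^'d) \<Rightarrow> nat \<Rightarrow> bool" where
  "close_to_half T \<epsilon> B c' \<longleftrightarrow>
     real T / 2 \<le> real (card {c \<in> {1..T}.
       \<forall>i \<in> {1..CARD('k)}. singular_value i (transpose (B c) ** B c') \<ge> 1 - 2 * \<epsilon>\<^sup>2})"

end

theory Submission
  imports Defs
begin

text \<open>
  By Hoeffding's inequality, with probability at least \<open>1 - \<delta>\<close> strictly more than half of the trials
  are successful. On this event any two successful trials \<open>c, c'\<close> are close to each other: inserting
  \<open>I = P P\<^sup>T + (I - P P\<^sup>T)\<close> with \<open>P = Bstar\<close> between \<open>B\<^sub>c\<^sup>T\<close> and \<open>B\<^sub>c\<^sub>'\<close>, the first part stretches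
  every vector by at least \<open>1 - \<epsilon>\<^sub>i\<^sup>2\<close> and the second by at most \<open>\<epsilon>\<^sub>i\<^sup>2\<close>. Conversely, an index that is
  close to half of all trials is close to a successful one, and the same splitting transfers
  the lower bound to \<open>P\<^sup>T B\<^sub>c\<^sub>'\<close>. The singular value condition is a statement about the quadratic
  form \<open>norm (A *v x)\<close> by the spectral theorem.
\<close>

section \<open>Diagonalization and singular values\<close>

text \<open>The Rayleigh quotient at \<open>v\<close> is compared with the one at \<open>v + t w\<close> for small \<open>t > 0\<close>,
  where \<open>w\<close> is the defect \<open>f v - (f v \<bullet> v) v\<close>.\<close>

lemma selfadjoint_max_eigenvector:
  fixes f :: "'a::euclidean_space \<Rightarrow> 'a"
  assumes "linear f" and self: "\<And>x y. f x \<bullet> y = x \<bullet> f y"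
    and W: "subspace W" "f ` W \<subseteq> W" and v: "v \<in> W" "norm v = 1"
    and max: "\<And>u. u \<in> W \<Longrightarrow> norm u = 1 \<Longrightarrow> f u \<bullet> u \<le> f v \<bullet> v"
  shows "f v = (f v \<bullet> v) *\<^sub>R v"
proof -
  interpret linear f by fact
  define d w where "d = f v \<bullet> v" and "w = f v - d *\<^sub>R v"
  have vv: "v \<bullet> v = 1" using v by (simp add: norm_eq_1)
  have max': "f u \<bullet> u \<le> d * (u \<bullet> u)" if "u \<in> W" for u
  proof (cases "u = 0")
    case False
    have "f (u /\<^sub>R norm u) \<bullet> (u /\<^sub>R norm u) \<le> d"
      unfolding d_def using False that W(1) by (intro max subspace_scale) auto
    then show ?thesis using False
      by (simp add: scale field_simps dot_square_norm power2_eq_square)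
  qed (simp add: zero)
  have wW: "w \<in> W"
    unfolding w_def using W v by (intro subspace_diff subspace_scale) auto
  have wvw: "(f v - d *\<^sub>R v) \<bullet> w = w \<bullet> w" by (simp add: w_def)
  \<comment> \<open>For \<open>u = v + t *\<^sub>R w\<close>, the difference
    \<open>d * (u \<bullet> u) - f u \<bullet> u\<close> has no constant term, linear coefficient
    \<open>- 2 * (w \<bullet> w)\<close> and quadratic coefficient \<open>C\<close>. It is
    nonnegative, so dividing by \<open>t\<close> and letting \<open>t\<close> tend to 0 forces
    \<open>w = 0\<close>.\<close>
  define C where "C = d * (w \<bullet> w) - f w \<bullet> w"
  have le: "2 * (w \<bullet> w) \<le> t * C" if "t > 0" for t
  proof -
    have "f (v + t *\<^sub>R w) \<bullet> (v + t *\<^sub>R w) \<le> d * ((v + t *\<^sub>R w) \<bullet> (v + t *\<^sub>R w))"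
      using W v wW by (intro max' subspace_add subspace_scale) auto
    moreover have "v \<bullet> f v = d" by (simp add: d_def inner_commute)
    moreover have "f w \<bullet> v = f v \<bullet> w" using self[of w v] by (simp add: inner_commute)
    ultimately have "t * (2 * ((f v - d *\<^sub>R v) \<bullet> w)) \<le> t * (t * C)"
      using vv by (simp add: C_def add scale inner_simps inner_commute algebra_simps)
    then show ?thesis using that wvw by simp
  qed
  have "((\<lambda>t. t * C) \<longlongrightarrow> 0 * C) (at_right 0)" by (intro tendsto_intros)
  then have "2 * (w \<bullet> w) \<le> 0 * C"
    by (rule tendsto_lowerbound) (auto simp: eventually_at_right_less eventually_at intro!: exI[of _ 1] le)
  then have "w \<bullet> w \<le> 0" by simp
  then have "w = 0" using inner_gt_zero_iff[of w] by linarith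
  then show ?thesis by (simp add: w_def d_def)
qed

text \<open>Induction on \<open>k\<close>: the orthogonal complement of the eigenvectors found so
  far is invariant under \<open>f\<close>, and a maximizer of the quadratic form on its unit sphere
  supplies the next one.\<close>

lemma selfadjoint_orthonormal_eigenvectors:
  fixes f :: "'a::euclidean_space \<Rightarrow> 'a"
  assumes "linear f" and self: "\<And>x y. f x \<bullet> y = x \<bullet> f y" and "k \<le> DIM('a)"
  shows "\<exists>B. finite B \<and> card B = k \<and> pairwise orthogonal B \<and>
           (\<forall>v\<in>B. norm v = 1 \<and> (\<exists>d. f v = d *\<^sub>R v))"
  using assms(3)
proof (induction k)
  case 0
  show ?case by (intro exI[of _ "{}"]) auto
next
  case (Suc k)
  then obtain B where B: "finite B" "card B = k" "pairwise orthogonal B"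
    "\<And>v. v \<in> B \<Longrightarrow> norm v = 1" "\<And>v. v \<in> B \<Longrightarrow> \<exists>d. f v = d *\<^sub>R v" by auto
  define W where "W = {y. \<forall>x\<in>B. orthogonal x y}"
  have W: "subspace W" unfolding W_def by (rule subspace_orthogonal_to_vectors)
  have fW: "f ` W \<subseteq> W"
  proof clarify
    fix y assume y: "y \<in> W"
    have "x \<bullet> f y = 0" if x: "x \<in> B" for x
    proof -
      obtain d where "f x = d *\<^sub>R x" using B x by blast
      moreover have "x \<bullet> y = 0" using x y by (auto simp: W_def orthogonal_def)
      ultimately show ?thesis by (simp flip: self)
    qed
    then show "f y \<in> W" by (simp add: W_def orthogonal_def)
  qed
  \<comment> \<open>The dimension count makes the complement nonzero, so the unit sphere on which
    the maximum is sought is nonempty.\<close>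
  have "dim B < DIM('a)" using dim_le_card'[OF B(1)] B(2) Suc.prems by simp
  then obtain u where u: "u \<noteq> 0" "\<And>y. y \<in> span B \<Longrightarrow> orthogonal u y"
    using orthogonal_to_subspace_exists by blast
  have uW: "u /\<^sub>R norm u \<in> sphere 0 1 \<inter> W"
    using u span_base by (auto simp: W_def orthogonal_def inner_commute)
  have "compact (sphere 0 1 \<inter> W)"
    using closed_subspace[OF W] by (intro compact_Int_closed) auto
  moreover have "continuous_on (sphere 0 1 \<inter> W) (\<lambda>x. f x \<bullet> x)"
    by (intro continuous_intros linear_continuous_on_compose[OF _ assms(1)])
  ultimately obtain v where v: "v \<in> sphere 0 1 \<inter> W"
      and max: "\<And>y. y \<in> sphere 0 1 \<inter> W \<Longrightarrow> f y \<bullet> y \<le> f v \<bullet> v"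
    using continuous_attains_sup[of "sphere 0 1 \<inter> W" "\<lambda>x. f x \<bullet> x"] uW by blast
  have ev: "f v = (f v \<bullet> v) *\<^sub>R v"
    using v max by (intro selfadjoint_max_eigenvector[OF assms(1,2) W fW]) auto
  have nv: "norm v = 1" and orth: "\<And>x. x \<in> B \<Longrightarrow> orthogonal x v"
    using v by (auto simp: W_def)
  then have "v \<notin> B" by (metis norm_zero orthogonal_self zero_neq_one)
  then show ?case using B ev nv orth
    by (intro exI[of _ "insert v B"]) (auto simp: pairwise_insert orthogonal_commute)
qed

lemma inner_matrix_vector: "x \<bullet> (A *v y) = (transpose A *v x) \<bullet> y"
  for A :: "real^'n^'m"
  by (simp add: dot_lmul_matrix)

text \<open>The columns of \<open>Q\<close> are the orthonormal eigenvectors, indexed through a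
  bijection. Stating the result as \<open>A ** Q = Q ** D\<close> reduces it to the eigenvector
  equations column by column, without an inverse.\<close>

lemma symmetric_matrix_diagonalization:
  fixes A :: "real^'n^'n"
  assumes sym: "transpose A = A"
  obtains Q :: "real^'n^'n" and d :: "'n \<Rightarrow> real"
  where "orthogonal_matrix Q" "A ** Q = Q ** (\<chi> i j. if i = j then d i else 0)"
proof -
  have "\<exists>B. finite B \<and> card B = CARD('n) \<and> pairwise orthogonal B \<and>
           (\<forall>v\<in>B. norm v = 1 \<and> (\<exists>d. A *v v = d *\<^sub>R v))"
  proof (rule selfadjoint_orthonormal_eigenvectors)
    show "(A *v x) \<bullet> y = x \<bullet> (A *v y)" for x y
      by (simp only: inner_matrix_vector[of x A] sym)
  qed auto
  then obtain B where B: "finite B" "card B = CARD('n)" "pairwise orthogonal B"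
    "\<And>v. v \<in> B \<Longrightarrow> norm v = 1" "\<And>v. v \<in> B \<Longrightarrow> \<exists>d. A *v v = d *\<^sub>R v" by blast
  obtain h :: "'n \<Rightarrow> real^'n" where h: "bij_betw h UNIV B"
    using finite_same_card_bij[of "UNIV :: 'n set" B] B(1,2) by auto
  have hB: "h i \<in> B" for i using h by (auto simp: bij_betw_def)
  have "\<forall>i. \<exists>d. A *v h i = d *\<^sub>R h i" using B(5)[OF hB] by blast
  from choice[OF this] obtain d where d: "A *v h i = d i *\<^sub>R h i" for i by blast
  define Q :: "real^'n^'n" where "Q = (\<chi> i j. h j $ i)"
  have col: "column j Q = h j" for j by (simp add: Q_def column_def vec_eq_iff)
  have "orthogonal (h i) (h j)" if "i \<noteq> j" for i j
    using h that by (intro pairwiseD[OF B(3)] hB) (auto simp: bij_betw_def inj_eq)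
  then have "orthogonal_matrix Q"
    unfolding orthogonal_matrix_orthonormal_columns col by (simp add: B(4)[OF hB])
  moreover have "A ** Q = Q ** (\<chi> i j. if i = j then d i else 0)"
  proof -
    have "(\<Sum>k\<in>UNIV. A $ i $ k * h j $ k) = d j * h j $ i" for i j
      using d[of j] by (simp add: vec_eq_iff matrix_vector_mult_def)
    then show ?thesis
      by (simp add: vec_eq_iff matrix_matrix_mult_def Q_def if_distrib cong: if_cong)
  qed
  ultimately show ?thesis by (rule that)
qed

section \<open>Characteristic polynomials and singular values\<close>

lemma poly_det: "poly (det M) x = det (\<chi> i j. poly (M $ i $ j) x)"
  for M :: "real poly^'n^'n"
  by (simp add: det_def poly_sum poly_prod)

lemma poly_charpoly: "poly (charpoly A) x = det (mat x - A)"
proof -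
  have "(\<chi> i j. poly ((mat [:0, 1:] - (\<chi> i j. [:A $ i $ j:])) $ i $ j) x) = mat x - A"
    by (simp add: vec_eq_iff mat_def)
  then show ?thesis unfolding charpoly_def poly_det by simp
qed

lemma matrix_diff_ldistrib: "A ** (B - C) = A ** B - A ** C"
  for A :: "'a::ring_1^'n^'m"
  by (simp add: vec_eq_iff matrix_matrix_mult_def right_diff_distrib sum_subtractf)

lemma matrix_diff_rdistrib: "(A - B) ** C = A ** C - B ** C"
  for A :: "'a::ring_1^'n^'m"
  by (simp add: vec_eq_iff matrix_matrix_mult_def left_diff_distrib sum_subtractf)

text \<open>Two real polynomials agree if their values do. At each \<open>x\<close>, taking
  determinants in \<open>(mat x - A) ** Q = Q ** (mat x - D)\<close> and cancelling
  \<open>det Q\<close>, which is 1 or -1, leaves a diagonal determinant.\<close>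

lemma charpoly_of_diagonalization:
  fixes A :: "real^'n^'n"
  assumes "orthogonal_matrix Q" and AQ: "A ** Q = Q ** (\<chi> i j. if i = j then d i else 0)"
  shows "charpoly A = (\<Prod>i\<in>UNIV. [:- d i, 1:])"
proof (rule iffD1[OF poly_eq_poly_eq_iff], rule ext)
  fix x
  let ?D = "\<chi> i j. if i = j then d i else (0::real)"
  have QQ: "transpose Q ** Q = mat 1" using assms(1) by (simp add: orthogonal_matrix)
  have "(mat x - A) ** Q = Q ** (mat x - ?D)"
  proof -
    have "(mat x - A) ** Q = mat x ** Q - A ** Q" by (rule matrix_diff_rdistrib)
    also have "mat x ** Q = Q ** mat x"
      by (simp add: vec_eq_iff matrix_matrix_mult_def mat_def if_distrib if_distribR mult.commute
          cong: if_cong)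
    also have "Q ** mat x - A ** Q = Q ** (mat x - ?D)"
      by (simp only: AQ matrix_diff_ldistrib)
    finally show ?thesis .
  qed
  from arg_cong[OF this, of det]
  have "det (mat x - A) * det Q = det Q * det (mat x - ?D)" by (simp only: det_mul)
  moreover have "det Q \<noteq> 0" using det_orthogonal_matrix[OF assms(1)] by auto
  ultimately have "det (mat x - A) = det (mat x - ?D)" by simp
  also have "\<dots> = (\<Prod>i\<in>UNIV. x - d i)"
    by (subst det_diagonal) (auto simp: mat_def)
  finally show "poly (charpoly A) x = poly (\<Prod>i\<in>UNIV. [:- d i, 1:]) x"
    by (simp add: poly_charpoly poly_prod)
qed

text \<open>A condition on all positions does not see the order of the list, so the sorting in
  \<open>singular_value\<close> disappears. The size assumption keeps every index in range.\<close>

lemma ball_descending_list_of_multiset: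
  assumes "size X = n"
  shows "(\<forall>i\<in>{1..n}. P (rev (sorted_list_of_multiset X) ! (i - 1))) \<longleftrightarrow> (\<forall>x\<in>#X. P x)"
proof -
  define xs where "xs = rev (sorted_list_of_multiset X)"
  have "mset xs = X" by (simp add: xs_def)
  then have *: "set xs = set_mset X" "length xs = n" using assms by (auto simp flip: size_mset)
  have "{..<n} = (\<lambda>i. i - 1) ` {1..n}" by (force simp: image_iff intro: bexI[of _ "Suc _"])
  then have "(\<forall>i\<in>{1..n}. P (xs ! (i - 1))) \<longleftrightarrow> (\<forall>i\<in>{..<n}. P (xs ! i))" by simp
  also have "\<dots> \<longleftrightarrow> (\<forall>x\<in>set xs. P x)" unfolding all_set_conv_all_nth *(2) by auto
  finally show ?thesis by (simp add: xs_def[symmetric] *)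
qed

lemma orthogonal_matrix_inner:
  fixes Q :: "real^'n^'n"
  assumes "orthogonal_matrix Q"
  shows "(Q *v x) \<bullet> (Q *v y) = x \<bullet> y"
proof -
  have "transpose Q *v (Q *v x) = x"
    using assms unfolding matrix_vector_mul_assoc by (simp add: orthogonal_matrix)
  then show ?thesis by (simp only: inner_matrix_vector[of _ Q])
qed

lemma orthogonal_matrix_norm:
  fixes Q :: "real^'n^'n"
  assumes "orthogonal_matrix Q"
  shows "norm (Q *v x) = norm x"
  by (simp add: norm_eq_sqrt_inner orthogonal_matrix_inner[OF assms])

text \<open>In the eigenbasis of \<open>transpose A ** A\<close> the squared norm of
  \<open>A *v x\<close> is the sum of \<open>d i * (y $ i)\<^sup>2\<close>, so a lower bound on all
  singular values is a lower bound on the stretching of every vector. All later arguments use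
  singular values only in this form.\<close>

lemma singular_values_ge_iff:
  fixes A :: "real^'n^'m"
  shows "(\<forall>i\<in>{1..CARD('n)}. t \<le> singular_value i A) \<longleftrightarrow> (\<forall>x. t * norm x \<le> norm (A *v x))"
proof -
  define S where "S = transpose A ** A"
  have symS: "transpose S = S" by (simp add: S_def matrix_transpose_mul)
  obtain Q and d :: "'n \<Rightarrow> real" where Q: "orthogonal_matrix Q"
    and SQ: "S ** Q = Q ** (\<chi> i j. if i = j then d i else 0)"
    using symmetric_matrix_diagonalization[OF symS] by blast
  have roots: "proots (charpoly S) = image_mset d (mset_set UNIV)"
    unfolding charpoly_of_diagonalization[OF Q SQ]
    by (subst proots_prod) (auto simp: sum_unfold_sum_mset)
  have "(norm (A *v (Q *v y)))\<^sup>2 = (\<Sum>i\<in>UNIV. d i * (y $ i)\<^sup>2)" for y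
  proof -
    have "(norm (A *v (Q *v y)))\<^sup>2 = (Q *v y) \<bullet> (S *v (Q *v y))"
      unfolding S_def matrix_vector_mul_assoc[symmetric] inner_matrix_vector[of _ "transpose A"]
      by (simp only: transpose_transpose power2_norm_eq_inner)
    also have "\<dots> = (Q *v y) \<bullet> (Q *v ((\<chi> i j. if i = j then d i else 0) *v y))"
      by (simp add: matrix_vector_mul_assoc SQ)
    also have "\<dots> = y \<bullet> ((\<chi> i j. if i = j then d i else 0) *v y)"
      by (rule orthogonal_matrix_inner[OF Q])
    also have "\<dots> = (\<Sum>i\<in>UNIV. d i * (y $ i)\<^sup>2)"
      by (simp add: inner_vec_def matrix_vector_mult_def if_distrib if_distribR power2_eq_square mult_ac
        cong: if_cong)
    finally show ?thesis .
  qed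
  note quad = this
  have "(\<forall>i\<in>{1..CARD('n)}. t \<le> singular_value i A) \<longleftrightarrow> (\<forall>j. t \<le> sqrt (d j))"
    unfolding singular_value_def S_def[symmetric]
    by (subst ball_descending_list_of_multiset) (auto simp: roots)
  also have "\<dots> \<longleftrightarrow> (\<forall>x. t * norm x \<le> norm (A *v x))"
  proof
    assume t: "\<forall>j. t \<le> sqrt (d j)"
    show "\<forall>x. t * norm x \<le> norm (A *v x)"
    proof
      fix x
      show "t * norm x \<le> norm (A *v x)"
      \<comment> \<open>Squaring requires \<open>t \<ge> 0\<close>, but the threshold
        \<open>1 - 2 * \<epsilon>\<^sup>2\<close> of the application can be negative.\<close>
      proof (cases "t \<ge> 0")
        case True
        define y where "y = transpose Q *v x"
        have x: "x = Q *v y"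
          unfolding y_def matrix_vector_mul_assoc using Q by (simp add: orthogonal_matrix_def)
        have "(t * norm x)\<^sup>2 = t\<^sup>2 * (norm y)\<^sup>2"
          by (simp add: x orthogonal_matrix_norm[OF Q] power_mult_distrib)
        also have "\<dots> = (\<Sum>i\<in>UNIV. t\<^sup>2 * (y $ i)\<^sup>2)"
          by (simp add: norm_vec_def L2_set_def sum_nonneg sum_distrib_left)
        also have "\<dots> \<le> (\<Sum>i\<in>UNIV. d i * (y $ i)\<^sup>2)"
          using t True by (intro sum_mono mult_right_mono) (auto simp: real_le_rsqrt sqrt_ge_absD)
        also have "\<dots> = (norm (A *v x))\<^sup>2" by (simp add: x quad)
        finally show ?thesis by (rule power2_le_imp_le) simp
      next
        case False
        then have "t * norm x \<le> 0" by (simp add: mult_nonpos_nonneg)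
        then show ?thesis using norm_ge_zero order_trans by blast
      qed
    qed
  next
    assume *: "\<forall>x. t * norm x \<le> norm (A *v x)"
    show "\<forall>j. t \<le> sqrt (d j)"
    proof
      fix j
      \<comment> \<open>Testing on the \<open>j\<close>-th eigenvector isolates \<open>d j\<close>
        and shows that it is a square, so its root is exactly that norm.\<close>
      have "(norm (A *v (Q *v axis j 1)))\<^sup>2 = d j"
        unfolding quad by (simp add: axis_def if_distrib[of "\<lambda>z. z\<^sup>2"] if_distrib[of "(*) _"]
            cong: if_cong)
      then have "sqrt (d j) = norm (A *v (Q *v axis j 1))" by (metis norm_ge_zero real_sqrt_unique)
      then show "t \<le> sqrt (d j)"
        using *[rule_format, of "Q *v axis j 1"] by (simp add: orthogonal_matrix_norm[OF Q])
    qed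
  qed
  finally show ?thesis .
qed

section \<open>The subspace distance\<close>

lemma orthonormal_columns_iff: "orthonormal_columns B \<longleftrightarrow> transpose B ** B = mat 1"
  by (simp add: orthonormal_columns_def vec_eq_iff matrix_matrix_mult_def transpose_def
      inner_vec_def column_def mat_def)

lemma orthonormal_columns_left_inverse:
  assumes "orthonormal_columns B"
  shows "transpose B *v (B *v x) = x"
  using assms unfolding orthonormal_columns_iff matrix_vector_mul_assoc by simp

lemma orthonormal_columns_norm:
  assumes "orthonormal_columns B"
  shows "norm (B *v x) = norm x"
  by (simp only: norm_eq_sqrt_inner inner_matrix_vector[of _ B] orthonormal_columns_left_inverse[OF assms])

lemma spectral_norm_le_iff:
  assumes "0 \<le> e"
  shows "spectral_norm A \<le> e \<longleftrightarrow> (\<forall>x. norm (A *v x) \<le> e * norm x)"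
proof
  assume le: "spectral_norm A \<le> e"
  show "\<forall>x. norm (A *v x) \<le> e * norm x"
  proof
    fix x
    have "norm (A *v x) \<le> spectral_norm A * norm x"
      unfolding spectral_norm_def by (rule onorm) simp
    also have "\<dots> \<le> e * norm x" using le by (rule mult_right_mono) simp
    finally show "norm (A *v x) \<le> e * norm x" .
  qed
next
  assume "\<forall>x. norm (A *v x) \<le> e * norm x"
  then show "spectral_norm A \<le> e"
    unfolding spectral_norm_def by (intro onorm_bound assms) auto
qed

text \<open>For orthonormal columns this is the component of \<open>z\<close> orthogonal to the
  column space of \<open>B\<close>.\<close>

definition proj_residual :: "real^'k^'d \<Rightarrow> real^'d \<Rightarrow> real^'d" where
  "proj_residual B z = z - B *v (transpose B *v z)"

lemma subspace_dist_le_iff: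
  assumes "0 \<le> e"
  shows "subspace_dist B B' \<le> e \<longleftrightarrow> (\<forall>x. norm (proj_residual B (B' *v x)) \<le> e * norm x)"
  unfolding subspace_dist_def spectral_norm_le_iff[OF assms] proj_residual_def
  by (simp only: matrix_vector_mul_assoc[symmetric] matrix_vector_mult_diff_rdistrib matrix_vector_mul_lid)

lemma transpose_proj_residual:
  assumes "orthonormal_columns B"
  shows "transpose B *v proj_residual B z = 0"
  by (simp only: proj_residual_def matrix_vector_mult_diff_distrib orthonormal_columns_left_inverse[OF assms]
      diff_self)

lemma proj_residual_decomp: "z = B *v (transpose B *v z) + proj_residual B z"
  by (simp add: proj_residual_def)

lemma inner_proj_residual:
  assumes "orthonormal_columns B"
  shows "proj_residual B z \<bullet> (B *v u) = 0"
  by (simp only: inner_matrix_vector[of _ B] transpose_proj_residual[OF assms] inner_zero_left)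

text \<open>Pythagoras for \<open>proj_residual_decomp\<close>, with \<open>B\<close> acting as an
  isometry: the squared sine of the angle between \<open>z\<close> and the column space is one minus
  its squared cosine.\<close>

lemma norm_proj_residual:
  assumes "orthonormal_columns B"
  shows "(norm (proj_residual B z))\<^sup>2 = (norm z)\<^sup>2 - (norm (transpose B *v z))\<^sup>2"
proof -
  have "(norm z)\<^sup>2 = (norm (B *v (transpose B *v z)))\<^sup>2 + (norm (proj_residual B z))\<^sup>2"
    by (subst proj_residual_decomp[of z B], subst norm_add_Pythagorean)
      (simp_all add: orthogonal_def inner_commute inner_proj_residual[OF assms] flip: proj_residual_decomp)
  then show ?thesis by (simp only: orthonormal_columns_norm[OF assms])
qed

lemma norm_transpose_orthonormal_columns_le:
  assumes "orthonormal_columns B"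
  shows "norm (transpose B *v z) \<le> norm z"
proof (rule power2_le_imp_le)
  have "0 \<le> (norm z)\<^sup>2 - (norm (transpose B *v z))\<^sup>2"
    by (simp only: norm_proj_residual[OF assms, symmetric] zero_le_power2)
  then show "(norm (transpose B *v z))\<^sup>2 \<le> (norm z)\<^sup>2" by (simp only: diff_ge_0_iff_ge)
qed simp

text \<open>The distance is the sine of the largest principal angle, and the least stretching by
  \<open>transpose B ** B'\<close> is its cosine. By Pythagoras the two bounds are equivalent for
  each \<open>x\<close> separately.\<close>

lemma subspace_dist_le_iff_cos:
  assumes "orthonormal_columns B" "orthonormal_columns B'" and e: "0 \<le> e" "e \<le> 1"
  shows "subspace_dist B B' \<le> e \<longleftrightarrow>
           (\<forall>x. sqrt (1 - e\<^sup>2) * norm x \<le> norm ((transpose B ** B') *v x))"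
proof -
  have "norm (proj_residual B (B' *v x)) \<le> e * norm x \<longleftrightarrow>
          sqrt (1 - e\<^sup>2) * norm x \<le> norm ((transpose B ** B') *v x)" for x
  proof -
    have "norm (proj_residual B (B' *v x)) \<le> e * norm x \<longleftrightarrow>
        (norm (proj_residual B (B' *v x)))\<^sup>2 \<le> (e * norm x)\<^sup>2"
      using e by (intro power_mono_iff[symmetric]) auto
    also have "\<dots> \<longleftrightarrow> (1 - e\<^sup>2) * (norm x)\<^sup>2 \<le> (norm ((transpose B ** B') *v x))\<^sup>2"
      unfolding norm_proj_residual[OF assms(1)] orthonormal_columns_norm[OF assms(2)]
        matrix_vector_mul_assoc
      by (simp add: power_mult_distrib left_diff_distrib) linarith
    also have "(1 - e\<^sup>2) * (norm x)\<^sup>2 = (sqrt (1 - e\<^sup>2) * norm x)\<^sup>2"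
      using e by (simp add: power_mult_distrib power_le_one)
    also have "\<dots> \<le> (norm ((transpose B ** B') *v x))\<^sup>2 \<longleftrightarrow>
        sqrt (1 - e\<^sup>2) * norm x \<le> norm ((transpose B ** B') *v x)"
      using e by (intro power_mono_iff) (auto simp: power_le_one)
    finally show ?thesis .
  qed
  then show ?thesis by (simp only: subspace_dist_le_iff[OF e(1)])
qed

text \<open>For \<open>s > 0\<close> the square matrix \<open>A\<close> is injective, hence
  surjective, so \<open>y = A *v x\<close> for some \<open>x\<close> with
  \<open>s * norm x \<le> norm y\<close>. Cauchy-Schwarz applied to
  \<open>(transpose A *v y) \<bullet> x\<close>, which is the squared norm of \<open>y\<close>, then
  gives the bound.\<close>

lemma norm_lower_bound_transpose:
  fixes A :: "real^'n^'n"
  assumes A: "\<And>x. s * norm x \<le> norm (A *v x)"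
  shows "s * norm y \<le> norm (transpose A *v y)"
proof (cases "s > 0")
  case True
  have "x = 0" if "A *v x = 0" for x
    using A[of x] True that by (simp add: mult_le_0_iff)
  then have "inj ((*v) A)" by (subst linear_injective_0) auto
  then have "surj ((*v) A)" by (intro linear_injective_imp_surjective) auto
  then obtain x where y: "y = A *v x" by (metis surjD)
  have "s * (norm y * norm y) = s * (y \<bullet> (A *v x))" by (simp only: norm_eq_square y power2_norm_eq_inner flip: power2_eq_square)
  also have "\<dots> = s * ((transpose A *v y) \<bullet> x)" by (simp only: inner_matrix_vector[of _ A])
  also have "\<dots> \<le> s * (norm (transpose A *v y) * norm x)"
    using True by (intro mult_left_mono norm_cauchy_schwarz) auto
  also have "\<dots> = norm (transpose A *v y) * (s * norm x)" by simp
  also have "\<dots> \<le> norm (transpose A *v y) * norm y"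
    unfolding y by (intro mult_left_mono A norm_ge_zero)
  finally have "norm y * (s * norm y) \<le> norm y * norm (transpose A *v y)" by (simp add: mult_ac)
  then show ?thesis by (cases "y = 0") auto
next
  case False
  then have "s * norm y \<le> 0" by (simp add: mult_nonpos_nonneg)
  then show ?thesis using norm_ge_zero order_trans by blast
qed

text \<open>Symmetry holds because \<open>B\<close> and \<open>B'\<close> have equally many columns: the square matrices
  \<open>B\<^sup>T B'\<close> and its transpose have the same smallest singular value.\<close>

lemma subspace_dist_le_sym:
  assumes "orthonormal_columns B" "orthonormal_columns B'" "0 \<le> e" "e \<le> 1"
    and "subspace_dist B B' \<le> e"
  shows "subspace_dist B' B \<le> e"
proof -
  have "transpose (transpose B ** B') = transpose B' ** B"
    by (simp only: matrix_transpose_mul transpose_transpose)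
  moreover have "sqrt (1 - e\<^sup>2) * norm x \<le> norm (transpose (transpose B ** B') *v x)" for x
    using assms(5) unfolding subspace_dist_le_iff_cos[OF assms(1-4)]
    by (intro norm_lower_bound_transpose) blast
  ultimately show ?thesis
    unfolding subspace_dist_le_iff_cos[OF assms(2,1,3,4)] by (simp only: simp_thms)
qed

section \<open>Transfer of bounds through a reference subspace\<close>

text \<open>On the complement of the column space of \<open>P\<close>, \<open>transpose B\<close> is
  the adjoint of \<open>B\<close> followed by \<open>proj_residual P\<close>, so it inherits the
  norm bound \<open>e\<close>.\<close>

lemma norm_transpose_proj_residual_le:
  assumes P: "orthonormal_columns P" and e: "0 \<le> e" and "subspace_dist P B \<le> e"
  shows "norm (transpose B *v proj_residual P z) \<le> e * norm (proj_residual P z)"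
proof -
  let ?r = "proj_residual P z" and ?w = "transpose B *v proj_residual P z"
  have "norm ?w * norm ?w = ?r \<bullet> (B *v ?w)"
    by (simp only: inner_matrix_vector[of _ B] power2_norm_eq_inner flip: power2_eq_square)
  also have "\<dots> = ?r \<bullet> proj_residual P (B *v ?w)"
    by (subst proj_residual_decomp[of "B *v ?w" P])
      (simp only: inner_add_right inner_proj_residual[OF P] add_0)
  also have "\<dots> \<le> norm ?r * norm (proj_residual P (B *v ?w))" by (rule norm_cauchy_schwarz)
  also have "\<dots> \<le> norm ?r * (e * norm ?w)"
    using assms(3) unfolding subspace_dist_le_iff[OF e] by (intro mult_left_mono) auto
  finally have "norm ?w * norm ?w \<le> norm ?w * (e * norm ?r)" by (simp add: mult_ac)
  then show ?thesis using e by (cases "?w = 0") auto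
qed

text \<open>The part through \<open>P\<close> meets two cosines, each at least
  \<open>sqrt (1 - e\<^sup>2)\<close>; the residual part meets two sines, each at most
  \<open>e\<close>. The reverse triangle inequality leaves
  \<open>(1 - e\<^sup>2) - e\<^sup>2\<close>.\<close>

lemma gram_matrix_lower_bound:
  assumes P: "orthonormal_columns P" and B: "orthonormal_columns B" and B': "orthonormal_columns B'"
    and e: "0 \<le> e" "e \<le> 1"
    and dB: "subspace_dist B P \<le> e" and dB': "subspace_dist B' P \<le> e"
  shows "(1 - 2 * e\<^sup>2) * norm x \<le> norm ((transpose B ** B') *v x)"
proof -
  let ?u = "transpose P *v (B' *v x)" and ?r = "proj_residual P (B' *v x)"
  have s: "sqrt (1 - e\<^sup>2) * sqrt (1 - e\<^sup>2) = 1 - e\<^sup>2" using e by (simp add: power_le_one)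
  \<comment> \<open>The residual is taken with respect to \<open>P\<close>, so both distances are
    needed with \<open>P\<close> as first argument.\<close>
  have dPB: "subspace_dist P B \<le> e" and dPB': "subspace_dist P B' \<le> e"
    by (rule subspace_dist_le_sym[OF B P e dB], rule subspace_dist_le_sym[OF B' P e dB'])
  have "(1 - e\<^sup>2) * norm x = sqrt (1 - e\<^sup>2) * (sqrt (1 - e\<^sup>2) * norm x)"
    by (simp only: s flip: mult.assoc)
  also have "\<dots> \<le> sqrt (1 - e\<^sup>2) * norm ?u"
    using dPB' e unfolding subspace_dist_le_iff_cos[OF P B' e] matrix_vector_mul_assoc
    by (intro mult_left_mono) (auto simp: power_le_one)
  also have "\<dots> \<le> norm (transpose B *v (P *v ?u))"
    using dB unfolding subspace_dist_le_iff_cos[OF B P e]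
    by (simp only: matrix_vector_mul_assoc[of "transpose B" P])
  finally have 1: "(1 - e\<^sup>2) * norm x \<le> norm (transpose B *v (P *v ?u))" .
  have "norm (transpose B *v ?r) \<le> e * norm ?r"
    by (rule norm_transpose_proj_residual_le[OF P e(1) dPB])
  also have "\<dots> \<le> e * (e * norm x)"
    using dPB' e(1) unfolding subspace_dist_le_iff[OF e(1)] by (intro mult_left_mono) auto
  finally have 2: "norm (transpose B *v ?r) \<le> e\<^sup>2 * norm x" by (simp add: power2_eq_square)
  have "(transpose B ** B') *v x = transpose B *v (P *v ?u) + transpose B *v ?r"
    by (simp only: matrix_vector_mul_assoc[symmetric] matrix_vector_right_distrib[symmetric]
        proj_residual_decomp[symmetric])
  then have "norm (transpose B *v (P *v ?u)) \<le> norm ((transpose B ** B') *v x) + norm (transpose B *v ?r)"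
    using norm_triangle_ineq4[of "(transpose B ** B') *v x" "transpose B *v ?r"]
    by (simp only: add_diff_cancel_right')
  moreover have "(1 - 2 * e\<^sup>2) * norm x = (1 - e\<^sup>2) * norm x - e\<^sup>2 * norm x"
    by (simp add: left_diff_distrib)
  ultimately show ?thesis using 1 2 by linarith
qed

text \<open>The same splitting read backwards: the residual part contributes at most
  \<open>e * norm x\<close>, so \<open>transpose P ** B'\<close> must stretch by at least
  \<open>t - e\<close>. As \<open>B'\<close> is not yet known to be close to \<open>P\<close>, its
  residual is bounded only by \<open>norm x\<close>.\<close>

lemma subspace_dist_le_of_gram_matrix:
  assumes P: "orthonormal_columns P" and B: "orthonormal_columns B" and B': "orthonormal_columns B'"
    and e: "0 \<le> e" "e \<le> 1" and e0: "0 \<le> e0" "e0 \<le> 1"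
    and dB: "subspace_dist B P \<le> e"
    and t: "\<And>x. t * norm x \<le> norm ((transpose B ** B') *v x)"
    and le: "sqrt (1 - e0\<^sup>2) + e \<le> t"
  shows "subspace_dist B' P \<le> e0"
proof (rule subspace_dist_le_sym[OF P B' e0], unfold subspace_dist_le_iff_cos[OF P B' e0], rule allI)
  fix x
  let ?u = "transpose P *v (B' *v x)" and ?r = "proj_residual P (B' *v x)"
  have "(norm ?r)\<^sup>2 \<le> (norm x)\<^sup>2"
    by (simp add: norm_proj_residual[OF P] orthonormal_columns_norm[OF B'])
  then have r: "norm ?r \<le> norm x" by (rule power2_le_imp_le) simp
  have "(sqrt (1 - e0\<^sup>2) + e) * norm x \<le> t * norm x" using le by (rule mult_right_mono) simp
  also have "\<dots> \<le> norm ((transpose B ** B') *v x)" by (rule t)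
  also have "(transpose B ** B') *v x = transpose B *v (P *v ?u) + transpose B *v ?r"
    by (simp only: matrix_vector_mul_assoc[symmetric] matrix_vector_right_distrib[symmetric]
        proj_residual_decomp[symmetric])
  also have "norm \<dots> \<le> norm (transpose B *v (P *v ?u)) + norm (transpose B *v ?r)"
    by (rule norm_triangle_ineq)
  also have "\<dots> \<le> norm ?u + e * norm x"
  proof (rule add_mono)
    show "norm (transpose B *v (P *v ?u)) \<le> norm ?u"
      using norm_transpose_orthonormal_columns_le[OF B, of "P *v ?u"]
      by (simp only: orthonormal_columns_norm[OF P])
    have "norm (transpose B *v ?r) \<le> e * norm ?r"
      by (rule norm_transpose_proj_residual_le[OF P e(1) subspace_dist_le_sym[OF B P e dB]])
    also have "\<dots> \<le> e * norm x" using r e(1) by (rule mult_left_mono)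
    finally show "norm (transpose B *v ?r) \<le> e * norm x" .
  qed
  finally show "sqrt (1 - e0\<^sup>2) * norm x \<le> norm ((transpose P ** B') *v x)"
    by (simp only: distrib_right add_le_cancel_right matrix_vector_mul_assoc)
qed

section \<open>Concentration and the main theorem\<close>

text \<open>The set is an intersection over \<open>x\<close> of closed conditions continuous in
  \<open>B\<close>. Closedness makes success of a trial a Borel event.\<close>

lemma closed_subspace_dist_le:
  fixes P :: "real^'k^'d"
  assumes "0 \<le> e"
  shows "closed {B :: real^'k^'d. subspace_dist B P \<le> e}"
  unfolding subspace_dist_le_iff[OF assms] proj_residual_def matrix_vector_mult_def transpose_def
  by (intro closed_Collect_all closed_Collect_le continuous_intros)

text \<open>Hoeffding's inequality for the success indicators, which take values between 0 and 1.
  The event includes the tie, so its complement is a strict majority.\<close>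

lemma (in prob_space) majority_of_indep_successes:
  assumes I: "finite I" "I \<noteq> {}" and X: "indep_vars (\<lambda>_. N) X I" and A: "A \<in> sets N"
    and p: "1/2 \<le> p" "\<And>i. i \<in> I \<Longrightarrow> p \<le> prob {\<omega> \<in> space M. X i \<omega> \<in> A}"
  shows "prob {\<omega> \<in> space M. real (card {i \<in> I. X i \<omega> \<in> A}) \<le> real (card I) / 2}
           \<le> exp (- 2 * real (card I) * (p - 1/2)\<^sup>2)"
proof -
  define n where "n = real (card I)"
  have n: "0 < n" using I by (simp add: n_def card_gt_0_iff)
  define Y :: "'b \<Rightarrow> 'a \<Rightarrow> real" where "Y i \<omega> = indicator A (X i \<omega>)" for i \<omega>
  have meas: "X i \<in> measurable M N" if "i \<in> I" for i
    using X that by (auto simp: indep_vars_def2)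
  interpret Hoeffding_ineq M I Y "\<lambda>_. 0" "\<lambda>_. 1" "\<Sum>i\<in>I. expectation (Y i)"
  proof unfold_locales
    show "indep_vars (\<lambda>_. borel) Y I"
      unfolding Y_def by (rule indep_vars_compose2[OF X]) (use A in simp)
  qed (auto simp: I Y_def indicator_def)
  have "expectation (Y i) = prob {\<omega> \<in> space M. X i \<omega> \<in> A}" if "i \<in> I" for i
  proof -
    have "expectation (Y i) = expectation (indicator {\<omega> \<in> space M. X i \<omega> \<in> A})"
      by (intro Bochner_Integration.integral_cong) (auto simp: Y_def indicator_def)
    then show ?thesis by (simp add: Int_absorb2 Collect_mono_iff)
  qed
  then have mu: "n * p \<le> (\<Sum>i\<in>I. expectation (Y i))"
    using sum_mono[of I "\<lambda>_. p" "\<lambda>i. expectation (Y i)"] p(2) by (simp add: n_def)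
  \<comment> \<open>The gap between the expected number of successes and one half of the trials. It
    is at least \<open>n * (p - 1/2)\<close>, and since this is nonnegative by
    \<open>1/2 \<le> p\<close>, the comparison survives squaring.\<close>
  define \<eta> where "\<eta> = (\<Sum>i\<in>I. expectation (Y i)) - n / 2"
  have \<eta>: "n * (p - 1/2) \<le> \<eta>" using mu by (simp add: \<eta>_def algebra_simps)
  have "0 \<le> n * (p - 1/2)" using n p(1) by simp
  then have "0 \<le> \<eta>" and sq: "(n * (p - 1/2))\<^sup>2 \<le> \<eta>\<^sup>2" using \<eta> by (auto intro: power_mono)
  have "(\<Sum>i\<in>I. Y i \<omega>) = real (card {i \<in> I. X i \<omega> \<in> A})" for \<omega>
    using I by (simp add: Y_def indicator_def sum.If_cases Int_def)
  then have "prob {\<omega> \<in> space M. real (card {i \<in> I. X i \<omega> \<in> A}) \<le> n / 2} \<le> exp (- 2 * \<eta>\<^sup>2 / n)"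
    using Hoeffding_ineq_le[OF \<open>0 \<le> \<eta>\<close>] n by (simp add: \<eta>_def n_def)
  also have "\<dots> \<le> exp (- 2 * n * (p - 1/2)\<^sup>2)"
    using sq n by (simp add: field_simps power2_eq_square)
  finally show ?thesis by (simp add: n_def)
qed

theorem lemmaF3:
  fixes M :: "'w measure"
    and Bstar :: "real^'k^'d"
    and B :: "nat \<Rightarrow> 'w \<Rightarrow> real^'k^'d"
    and p \<delta> \<epsilon>\<^sub>0 \<epsilon>\<^sub>i :: real
    and T\<^sub>0 :: nat
  assumes "CARD('k) \<le> CARD('d)"
    and "orthonormal_columns Bstar"
    and "p = 0.99"
    and "0 < \<delta>" "\<delta> < 1"
    and "0 \<le> \<epsilon>\<^sub>0" "\<epsilon>\<^sub>0 \<le> 1"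
    and "0 \<le> \<epsilon>\<^sub>i" "\<epsilon>\<^sub>i \<le> 1"
    and "T\<^sub>0 = nat \<lceil>8 * p * ln (1 / \<delta>)\<rceil>"
    and "prob_space M"
    and "prob_space.indep_vars M (\<lambda>_. borel) B {1..T\<^sub>0}"
    and "\<And>c \<omega>. c \<in> {1..T\<^sub>0} \<Longrightarrow> \<omega> \<in> space M \<Longrightarrow> orthonormal_columns (B c \<omega>)"
    and "\<And>c. c \<in> {1..T\<^sub>0} \<Longrightarrow>
           measure M {\<omega> \<in> space M. subspace_dist (B c \<omega>) Bstar \<le> \<epsilon>\<^sub>i} \<ge> p"
  shows "(\<exists>E \<in> sets M. measure M E \<ge> 1 - \<delta> \<and>
           (\<forall>\<omega> \<in> E.
              (\<exists>c' \<in> {1..T\<^sub>0}. close_to_half T\<^sub>0 \<epsilon>\<^sub>i (\<lambda>c. B c \<omega>) c') \<and>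
              (sqrt (1 - \<epsilon>\<^sub>0\<^sup>2) + 1 - sqrt (1 - \<epsilon>\<^sub>i\<^sup>2) + \<epsilon>\<^sub>i < 1 - 2 * \<epsilon>\<^sub>i\<^sup>2 \<longrightarrow>
                (\<forall>c' \<in> {1..T\<^sub>0}. close_to_half T\<^sub>0 \<epsilon>\<^sub>i (\<lambda>c. B c \<omega>) c' \<longrightarrow>
                   subspace_dist (B c' \<omega>) Bstar \<le> \<epsilon>\<^sub>0)))) \<and>
         sqrt (1 - 0.2\<^sup>2) + 1 - sqrt (1 - 0.01\<^sup>2) + 0.01 < 1 - 2 * (0.01\<^sup>2 :: real)"
proof (rule conjI)
  note star = assms(2) and e0 = assms(6,7) and ei = assms(8,9) and orth = assms(13)
  interpret prob_space M by fact
  define A where "A = {C :: real^'k^'d. subspace_dist C Bstar \<le> \<epsilon>\<^sub>i}"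
  define bad where "bad = {\<omega> \<in> space M. real (card {c \<in> {1..T\<^sub>0}. B c \<omega> \<in> A}) \<le> real T\<^sub>0 / 2}"
  have A: "A \<in> sets borel"
    unfolding A_def by (intro borel_closed closed_subspace_dist_le ei)
  have ln: "0 < ln (1 / \<delta>)" using assms(4,5) by simp
  \<comment> \<open>Positivity of the logarithm makes the number of trials positive, as the
    concentration bound needs a nonempty index set.\<close>
  then have T: "8 * p * ln (1 / \<delta>) \<le> real T\<^sub>0" "0 < T\<^sub>0"
    using assms(3) unfolding assms(10) by (auto intro: of_nat_ceiling)
  have meas: "B c \<in> borel_measurable M" if "c \<in> {1..T\<^sub>0}" for c
    using assms(12) that by (auto simp: indep_vars_def2)
  \<comment> \<open>The number of successes is written as a sum of indicators to obtain
    measurability of \<open>bad\<close>.\<close>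
  have "(\<lambda>\<omega>. \<Sum>c\<in>{1..T\<^sub>0}. indicator A (B c \<omega>) :: real) \<in> borel_measurable M"
    by (intro borel_measurable_sum measurable_compose[OF meas borel_measurable_indicator[OF A]])
  then have "{\<omega> \<in> space M. (\<Sum>c\<in>{1..T\<^sub>0}. indicator A (B c \<omega>)) \<le> real T\<^sub>0 / 2} \<in> sets M"
    unfolding borel_measurable_iff_le by blast
  also have "{\<omega> \<in> space M. (\<Sum>c\<in>{1..T\<^sub>0}. indicator A (B c \<omega>)) \<le> real T\<^sub>0 / 2} = bad"
    unfolding bad_def by (simp add: indicator_def sum.If_cases Int_def)
  finally have bad: "bad \<in> sets M" .
  have "prob bad \<le> exp (- 2 * real (card {1..T\<^sub>0}) * (p - 1/2)\<^sup>2)"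
    unfolding bad_def using assms(3,14) T(2)
    by (intro order_trans[OF _ majority_of_indep_successes[OF _ _ assms(12) A]]) (auto simp: A_def)
  \<comment> \<open>Here \<open>2 * (p - 1/2)\<^sup>2 = 0.4802\<close>, and
    \<open>0.4802 * 8 * p\<close> is about 3.8, hence above 1.\<close>
  also have "\<dots> \<le> exp (- ln (1 / \<delta>))"
  proof -
    have p: "p = 99/100" using assms(3) by simp
    have sq: "(p - 1/2)\<^sup>2 = 2401/10000" by (simp add: p power2_eq_square)
    have "ln (1 / \<delta>) \<le> 2 * (2401/10000) * real T\<^sub>0" using T(1) ln unfolding p by linarith
    then show ?thesis unfolding sq by simp
  qed
  also have "\<dots> = \<delta>" using assms(4) by (simp add: ln_div)
  finally have prob_bad: "prob bad \<le> \<delta>" .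
  show "\<exists>E \<in> sets M. measure M E \<ge> 1 - \<delta> \<and>
           (\<forall>\<omega> \<in> E.
              (\<exists>c' \<in> {1..T\<^sub>0}. close_to_half T\<^sub>0 \<epsilon>\<^sub>i (\<lambda>c. B c \<omega>) c') \<and>
              (sqrt (1 - \<epsilon>\<^sub>0\<^sup>2) + 1 - sqrt (1 - \<epsilon>\<^sub>i\<^sup>2) + \<epsilon>\<^sub>i < 1 - 2 * \<epsilon>\<^sub>i\<^sup>2 \<longrightarrow>
                (\<forall>c' \<in> {1..T\<^sub>0}. close_to_half T\<^sub>0 \<epsilon>\<^sub>i (\<lambda>c. B c \<omega>) c' \<longrightarrow>
                   subspace_dist (B c' \<omega>) Bstar \<le> \<epsilon>\<^sub>0)))"
  proof (intro bexI[of _ "space M - bad"] conjI ballI impI)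
    show "measure M (space M - bad) \<ge> 1 - \<delta>"
      using prob_bad by (simp add: prob_compl[OF bad])
    show "space M - bad \<in> sets M" using bad by blast
  next
    fix \<omega> assume \<omega>: "\<omega> \<in> space M - bad"
    define S where "S = {c \<in> {1..T\<^sub>0}. B c \<omega> \<in> A}"
    have cardS: "real T\<^sub>0 / 2 < real (card S)" using \<omega> by (auto simp: bad_def S_def)
    then have "S \<noteq> {}" by auto
    \<comment> \<open>Any successful trial is a witness, because it is close to every other
      successful one.\<close>
    then obtain c' where c': "c' \<in> S" by blast
    have "S \<subseteq> {c \<in> {1..T\<^sub>0}. \<forall>i \<in> {1..CARD('k)}.
        singular_value i (transpose (B c \<omega>) ** B c' \<omega>) \<ge> 1 - 2 * \<epsilon>\<^sub>i\<^sup>2}"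
      unfolding singular_values_ge_iff
      using c' \<omega> by (auto simp: S_def A_def intro!: gram_matrix_lower_bound[OF star orth orth ei])
    then have "card S \<le> card {c \<in> {1..T\<^sub>0}. \<forall>i \<in> {1..CARD('k)}.
        singular_value i (transpose (B c \<omega>) ** B c' \<omega>) \<ge> 1 - 2 * \<epsilon>\<^sub>i\<^sup>2}"
      by (intro card_mono) auto
    then have "close_to_half T\<^sub>0 \<epsilon>\<^sub>i (\<lambda>c. B c \<omega>) c'"
      unfolding close_to_half_def using cardS by linarith
    then show "\<exists>c' \<in> {1..T\<^sub>0}. close_to_half T\<^sub>0 \<epsilon>\<^sub>i (\<lambda>c. B c \<omega>) c'"
      using c' by (auto simp: S_def)
  next
    fix \<omega> c'
    assume \<omega>: "\<omega> \<in> space M - bad" and c': "c' \<in> {1..T\<^sub>0}"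
      and small: "sqrt (1 - \<epsilon>\<^sub>0\<^sup>2) + 1 - sqrt (1 - \<epsilon>\<^sub>i\<^sup>2) + \<epsilon>\<^sub>i < 1 - 2 * \<epsilon>\<^sub>i\<^sup>2"
      and half: "close_to_half T\<^sub>0 \<epsilon>\<^sub>i (\<lambda>c. B c \<omega>) c'"
    define S where "S = {c \<in> {1..T\<^sub>0}. B c \<omega> \<in> A}"
    define C where "C = {c \<in> {1..T\<^sub>0}. \<forall>i \<in> {1..CARD('k)}.
        singular_value i (transpose (B c \<omega>) ** B c' \<omega>) \<ge> 1 - 2 * \<epsilon>\<^sub>i\<^sup>2}"
    have "real T\<^sub>0 / 2 < real (card S)" using \<omega> by (auto simp: bad_def S_def)
    moreover have "real T\<^sub>0 / 2 \<le> real (card C)"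
      using half by (simp only: close_to_half_def C_def)
    \<comment> \<open>The majority in \<open>S\<close> is strict while \<open>C\<close> may hold
      exactly half; the strictness forces the two sets to meet.\<close>
    ultimately have gt: "T\<^sub>0 < card S + card C" by linarith
    have "S \<inter> C \<noteq> {}"
    proof
      assume "S \<inter> C = {}"
      then have "card S + card C = card (S \<union> C)"
        by (intro card_Un_disjoint[symmetric]) (auto simp: S_def C_def)
      also have "\<dots> \<le> card {1..T\<^sub>0}" by (intro card_mono) (auto simp: S_def C_def)
      finally show False using gt by simp
    qed
    then obtain c where c: "c \<in> S" "c \<in> C" by blast
    \<comment> \<open>The term \<open>1 - sqrt (1 - \<epsilon>\<^sub>i\<^sup>2)\<close> is
      nonnegative, so the smallness condition yields the inequality in the form used by the transfer
      lemma.\<close>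
    have "sqrt (1 - \<epsilon>\<^sub>i\<^sup>2) \<le> 1" by simp
    with small have le: "sqrt (1 - \<epsilon>\<^sub>0\<^sup>2) + \<epsilon>\<^sub>i \<le> 1 - 2 * \<epsilon>\<^sub>i\<^sup>2" by linarith
    show "subspace_dist (B c' \<omega>) Bstar \<le> \<epsilon>\<^sub>0"
    proof (rule subspace_dist_le_of_gram_matrix[OF star _ _ ei e0 _ _ le])
      show "orthonormal_columns (B c \<omega>)" "orthonormal_columns (B c' \<omega>)"
        using c c' \<omega> by (auto simp: S_def intro: orth)
      show "subspace_dist (B c \<omega>) Bstar \<le> \<epsilon>\<^sub>i" using c by (simp add: S_def A_def)
      show "(1 - 2 * \<epsilon>\<^sub>i\<^sup>2) * norm x \<le> norm ((transpose (B c \<omega>) ** B c' \<omega>) *v x)" for x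
        using c(2) unfolding C_def singular_values_ge_iff by blast
    qed
  qed
next
  \<comment> \<open>Rational bounds suffice: the left side is at most 0.98 + 1 - 0.9999 + 0.01 =
    0.9901, and the right side is 0.9998.\<close>
  have "sqrt (1 - 0.2\<^sup>2) \<le> (0.98 :: real)" by (rule real_le_lsqrt) (simp_all add: power2_eq_square)
  moreover have "(0.9999 :: real) \<le> sqrt (1 - 0.01\<^sup>2)"
    by (rule real_le_rsqrt) (simp add: power2_eq_square)
  ultimately show "sqrt (1 - 0.2\<^sup>2) + 1 - sqrt (1 - 0.01\<^sup>2) + 0.01 < 1 - 2 * (0.01\<^sup>2 :: real)"
    by (simp add: power2_eq_square)
qed

end
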